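(* Let $\succ$ and $\succ_0$ be preference relations over the same relation schema such that $\succ_0$ is an interval order (IO), $\succ$ is a strict partial order (SPO), and $\succ$ is $1$-compatible with $\succ_0$. Then the preference relation $TC(\succ_0\triangleright\succ)$ is an SPO.
   Context: A relation schema $R(A_1,\dots,A_k)$ assigns each attribute $A_i$ a domain $U_i$, either a countably infinite set $D$ of uninterpreted constants or the set $\mathbb{Q}$ of rational numbers; tuples are elements of $U=U_1\times\cdots\times U_k$. A preference relation over $R$ is any subset of $U\times U$ (possibly infinite). A preference relation $\succ$ is an SPO if it is irreflexive and transitive; it is an IO if it is an SPO and for all $x,y,z,w$, $(x\succ y\wedge z\succ w)$ implies $(x\succ w\vee z\succ y)$. Prioritized composition: $t_1(\succ_0\triangleright\succ)t_2$ iff $t_1\succ_0 t_2\vee(t_2\not\succ_0 t_1\wedge t_1\succ t_2)$. $TC(\cdot)$ denotes transitive closure (chains of length $\ge 1$). A $1$-conflict between $\succ$ and $\succ_0$ is a pair $(t_1,t_2)$ such that $t_1\succ_0 t_2$ and there exist $s_1,\dots,s_k$, $k\ge 1$, with $t_2\succ s_1\succ\cdots\succ s_k\succ t_1$ and $t_1\not\succ_0 s_k\not\succ_0\cdots\not\succ_0 s_1\not\succ_0 t_2$ (i.e. $t_1\not\succ_0 s_k$, $s_{j+1}\not\succ_0 s_j$ for $1\le j<k$, and $s_1\not\succ_0 t_2$). The relation $\succ$ is $1$-compatible with $\succ_0$ if there are no $1$-conflicts between $\succ$ and $\succ_0$. *)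

theory Defs
  imports Main "HOL-Library.Countable_Set"
begin

datatype attr_dom = Uninterpreted | Rational

text \<open>A schema lists the domains of its attributes; attribute names play no role.\<close>

type_synonym schema = "attr_dom list"

text \<open>The type is tagged because uninterpreted constants and rationals are distinct kinds of values.\<close>

datatype 'd attr_value = Const 'd | Num rat

fun dom_values :: "'d set \<Rightarrow> attr_dom \<Rightarrow> 'd attr_value set" where
  "dom_values D Uninterpreted = Const ` D"
| "dom_values D Rational = range Num"

text \<open>\<open>listset [U\<^sub>1, \<dots>, U\<^sub>k]\<close> is the Cartesian product, its elements being lists of length \<open>k\<close>.\<close>

definition tuples :: "'d set \<Rightarrow> schema \<Rightarrow> 'd attr_value list set" where
  "tuples D R = listset (map (dom_values D) R)"

definition preference_relation :: "'d set \<Rightarrow> schema \<Rightarrow> 'd attr_value list rel \<Rightarrow> bool" where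
  "preference_relation D R P \<longleftrightarrow> P \<subseteq> tuples D R \<times> tuples D R"

text \<open>Below, irreflexivity, transitivity and the quantified elements range over the whole type.
  For \<open>P \<subseteq> U \<times> U\<close> this agrees with ranging over \<open>U\<close>, since the premises (or, for
  irreflexivity, the violating pair) force the elements into \<open>U\<close>.\<close>

definition is_SPO :: "'a rel \<Rightarrow> bool" where
  "is_SPO P \<longleftrightarrow> irrefl P \<and> trans P"

definition is_IO :: "'a rel \<Rightarrow> bool" where
  "is_IO P \<longleftrightarrow> is_SPO P \<and>
     (\<forall>x y z w. (x, y) \<in> P \<and> (z, w) \<in> P \<longrightarrow> (x, w) \<in> P \<or> (z, y) \<in> P)"

definition prioritized :: "'a rel \<Rightarrow> 'a rel \<Rightarrow> 'a rel"  (infixr "\<triangleright>" 70) where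
  "P0 \<triangleright> P = {(t1, t2). (t1, t2) \<in> P0 \<or> ((t2, t1) \<notin> P0 \<and> (t1, t2) \<in> P)}"

text \<open>Only the values \<open>s 1, \<dots>, s k\<close> of the sequence \<open>s\<close> matter.\<close>

definition one_conflict :: "'a rel \<Rightarrow> 'a rel \<Rightarrow> 'a \<Rightarrow> 'a \<Rightarrow> bool" where
  "one_conflict P P0 t1 t2 \<longleftrightarrow> (t1, t2) \<in> P0 \<and>
     (\<exists>(k::nat) s. k \<ge> 1 \<and>
        (t2, s 1) \<in> P \<and> (\<forall>j. 1 \<le> j \<and> j < k \<longrightarrow> (s j, s (j + 1)) \<in> P) \<and> (s k, t1) \<in> P \<and>
        (t1, s k) \<notin> P0 \<and> (\<forall>j. 1 \<le> j \<and> j < k \<longrightarrow> (s (j + 1), s j) \<notin> P0) \<and> (s 1, t2) \<notin> P0)"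

definition one_compatible :: "'a rel \<Rightarrow> 'a rel \<Rightarrow> bool" where
  "one_compatible P P0 \<longleftrightarrow> \<not> (\<exists>t1 t2. one_conflict P P0 t1 t2)"

end

theory Submission
  imports Defs
begin

text \<open>Write \<open>B\<close> for the pairs of \<open>P\<close> whose converse is not in \<open>P0\<close>, so that \<open>P0 \<triangleright> P = P0 \<union> B\<close>.
  In a cycle with two \<open>P0\<close>-edges \<open>x \<rightarrow> y\<close> and \<open>z \<rightarrow> w\<close>, the interval order condition supplies one
  of the chords \<open>x \<rightarrow> w\<close> and \<open>z \<rightarrow> y\<close>, either of which yields a cycle with fewer \<open>P0\<close>-edges.
  Hence any cycle reduces to one that lies in \<open>B \<subseteq> P\<close>, which is impossible, or to one with a single
  \<open>P0\<close>-edge, which is a 1-conflict.\<close>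

definition unopposed :: "'a rel \<Rightarrow> 'a rel \<Rightarrow> 'a rel" where
  "unopposed P P0 = P - P0\<inverse>"

lemma prioritized_eq: "P0 \<triangleright> P = P0 \<union> unopposed P P0"
  by (auto simp: prioritized_def unopposed_def)

lemma trancl_Un_cases:
  assumes "(a, b) \<in> (R \<union> S)\<^sup>+"
  shows "(a, b) \<in> S\<^sup>+ \<or> (\<exists>u v. (a, u) \<in> (R \<union> S)\<^sup>* \<and> (u, v) \<in> R \<and> (v, b) \<in> (R \<union> S)\<^sup>*)"
  using assms
proof (induction rule: trancl_induct)
  case (base y)
  then show ?case by blast
next
  case (step y z)
  show ?case
  proof (cases "(y, z) \<in> R")
    case True
    then show ?thesis using step.hyps(1) by (blast dest: trancl_into_rtrancl)
  next
    case False
    then have "(y, z) \<in> S" using step.hyps(2) by blast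
    then show ?thesis using step.IH step.hyps(2)
      by (blast intro: trancl_into_trancl rtrancl_into_rtrancl)
  qed
qed

text \<open>Induction walks along the path towards the fixed \<open>x\<close>; \<open>v\<close> is
  generalized so that the stretch from \<open>v\<close> to the current vertex always consists of
  \<open>B\<close>-edges.\<close>

lemma IO_cycle_reduction:
  assumes IO: "is_IO P0"
    and path: "(y, x) \<in> (P0 \<union> B)\<^sup>*"
    and "(x, v) \<in> P0" "(v, y) \<in> B\<^sup>*"
  shows "\<exists>u w. (u, w) \<in> P0 \<and> (w, u) \<in> B\<^sup>*"
  using path assms(3,4)
proof (induction arbitrary: v rule: converse_rtrancl_induct)
  case base
  then show ?case by blast
next
  case (step y z)
  show ?case
  proof (cases "(y, z) \<in> P0")
    case True
    \<comment> \<open>The chord \<open>(x, z)\<close> restarts with \<open>z\<close> as the new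
      \<open>v\<close> and an empty \<open>B\<close>-path; the chord \<open>(y, v)\<close> closes a
      cycle at once.\<close>
    then have "(x, z) \<in> P0 \<or> (y, v) \<in> P0"
      using IO step.prems(1) unfolding is_IO_def by blast
    then show ?thesis using step.IH step.prems(2) by blast
  next
    case False
    then show ?thesis using step by (blast intro: rtrancl_into_rtrancl)
  qed
qed

lemma one_conflictI:
  assumes "irrefl P0" and edge: "(x, y) \<in> P0" and path: "(y, x) \<in> (unopposed P P0)\<^sup>*"
  shows "one_conflict P P0 x y"
proof -
  obtain n f where f: "f 0 = y" "f n = x" "\<And>i. i < n \<Longrightarrow> (f i, f (Suc i)) \<in> unopposed P P0"
    using path by (auto simp: rtrancl_power relpow_fun_conv)
  have "n \<noteq> 0" using f(1,2) edge \<open>irrefl P0\<close> by (metis irreflD)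
  \<comment> \<open>A single step from \<open>y\<close> to \<open>x\<close> would be opposed by the
    edge \<open>(x, y)\<close> itself, so interior vertices \<open>f 1\<close>, ...,
    \<open>f k\<close> exist and form the conflict sequence.\<close>
  moreover have "n \<noteq> 1" using f(1,2) f(3)[of 0] edge by (auto simp: unopposed_def)
  ultimately obtain k where n: "n = Suc k" and "k \<ge> 1" by (cases n) auto
  have *: "(f i, f (Suc i)) \<in> P \<and> (f (Suc i), f i) \<notin> P0" if "i \<le> k" for i
    using f(3)[of i] that n by (auto simp: unopposed_def)
  show ?thesis
    unfolding one_conflict_def
  proof (intro conjI exI[of _ k] exI[of _ f])
  qed (use edge \<open>k \<ge> 1\<close> * *[of 0] *[of k] f(1,2) n in auto)
qed

lemma acyclic_prioritized:
  assumes "is_IO P0" "is_SPO P" "one_compatible P P0"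
  shows "acyclic (P0 \<triangleright> P)"
proof -
  let ?B = "unopposed P P0"
  have irr: "irrefl P0" using assms(1) by (simp add: is_IO_def is_SPO_def)
  have "(c, c) \<notin> (P0 \<union> ?B)\<^sup>+" for c
  proof
    assume cyc: "(c, c) \<in> (P0 \<union> ?B)\<^sup>+"
    have "?B\<^sup>+ \<subseteq> P\<^sup>+" by (intro trancl_mono_subset) (auto simp: unopposed_def)
    then have "(c, c) \<notin> ?B\<^sup>+" using assms(2) by (auto simp: is_SPO_def irrefl_def)
    \<comment> \<open>The cycle is rotated to start with its \<open>P0\<close>-edge: from
      \<open>v\<close> on to \<open>c\<close>, then from \<open>c\<close> to
      \<open>u\<close>.\<close>
    then obtain u v where "(u, v) \<in> P0" "(v, u) \<in> (P0 \<union> ?B)\<^sup>*"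
      using trancl_Un_cases[OF cyc] by (meson rtrancl_trans)
    then obtain x y where "(x, y) \<in> P0" "(y, x) \<in> ?B\<^sup>*"
      using IO_cycle_reduction[OF assms(1)] by blast
    then show False
      using one_conflictI[OF irr] assms(3) unfolding one_compatible_def by blast
  qed
  then show ?thesis by (simp add: acyclic_def prioritized_eq)
qed

theorem theorem2:
  fixes D :: "'d set" and R :: schema and P P0 :: "'d attr_value list rel"
  assumes "countable D" and "infinite D"
    and "preference_relation D R P" and "preference_relation D R P0"
    and "is_IO P0"
    and "is_SPO P"
    and "one_compatible P P0"
  shows "preference_relation D R ((P0 \<triangleright> P)\<^sup>+) \<and> is_SPO ((P0 \<triangleright> P)\<^sup>+)"
proof
  have "P0 \<triangleright> P \<subseteq> tuples D R \<times> tuples D R"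
    using assms(3,4) by (auto simp: preference_relation_def prioritized_def)
  then show "preference_relation D R ((P0 \<triangleright> P)\<^sup>+)"
    unfolding preference_relation_def by (rule trancl_subset_Sigma)
  show "is_SPO ((P0 \<triangleright> P)\<^sup>+)"
    using acyclic_prioritized[OF assms(5-7)] by (simp add: is_SPO_def acyclic_irrefl)
qed

end
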